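(* Let $c\neq 0$ and $\lambda>0$ be real constants, and let $I\subset\mathbb{R}$ be an open interval on which $\cos\left(\frac{u}{c}\right)>0$ and $1-\frac{\lambda^2}{c^2}\sin^2\left(\frac{u}{c}\right)>0$. Let $\phi:I\to\mathbb{R}$ be a smooth function with $|\phi'(u)|=\sqrt{1-\frac{\lambda^2}{c^2}\sin^2\left(\frac{u}{c}\right)}$. Let $M$ be the spherical surface in $\mathbb{E}^3$ given by the patch $$X(u,v)=\left(\phi(u),\ \lambda\cos\left(\tfrac{u}{c}\right)\cos v,\ \lambda\cos\left(\tfrac{u}{c}\right)\sin v\right),\qquad u\in I,\ v\in\mathbb{R}.$$ Then the Gaussian curvature $K$ and the mean curvature $H$ of $M$ are $$K=\frac{1}{c^2},\qquad H=\frac{\frac{2\lambda^2}{c^2}\cos^2\left(\frac{u}{c}\right)-\frac{\lambda^2}{c^2}+1}{2\lambda\cos\left(\frac{u}{c}\right)\sqrt{1-\frac{\lambda^2}{c^2}\sin^2\left(\frac{u}{c}\right)}}.$$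
   Context: For a regular patch $X(u,v)$ in $\mathbb{E}^3$ with first fundamental form coefficients $g_{11}=\langle X_u,X_u\rangle$, $g_{12}=\langle X_u,X_v\rangle$, $g_{22}=\langle X_v,X_v\rangle$, unit normal $N$, second fundamental form coefficients $L_{11}=\langle X_{uu},N\rangle$, $L_{12}=\langle X_{uv},N\rangle$, $L_{22}=\langle X_{vv},N\rangle$, and $W^2=g_{11}g_{22}-g_{12}^2\neq 0$: the Gaussian curvature is $K=\frac{L_{11}L_{22}-L_{12}^2}{W^2}$, the mean curvature vector is $\overrightarrow{H}=\frac{L_{11}g_{22}+L_{22}g_{11}-2L_{12}g_{12}}{2W^2}N$, and the mean curvature is its norm $H=\|\overrightarrow{H}\|$. *)

theory Defs
  imports "HOL-Analysis.Analysis"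
begin

text \<open>
  The iterated derivatives are two-sided ones taken at points of \<open>S\<close>, so this is the
  usual \<open>C\<^sup>\<infinity>\<close> notion when \<open>S\<close> is open; values of \<open>f\<close> outside \<open>S\<close> are then irrelevant.
\<close>

definition smooth_real_on :: "real set \<Rightarrow> (real \<Rightarrow> real) \<Rightarrow> bool" where
  "smooth_real_on S f \<longleftrightarrow> (\<forall>n. \<forall>x\<in>S. (deriv ^^ n) f field_differentiable at x)"

type_synonym patch = "real \<Rightarrow> real \<Rightarrow> real ^ 3"

definition partial_u :: "patch \<Rightarrow> patch" where
  "partial_u X u v = vector_derivative (\<lambda>s. X s v) (at u)"

definition partial_v :: "patch \<Rightarrow> patch" where
  "partial_v X u v = vector_derivative (\<lambda>t. X u t) (at v)"

definition g11 :: "patch \<Rightarrow> real \<Rightarrow> real \<Rightarrow> real" where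
  "g11 X u v = partial_u X u v \<bullet> partial_u X u v"

definition g12 :: "patch \<Rightarrow> real \<Rightarrow> real \<Rightarrow> real" where
  "g12 X u v = partial_u X u v \<bullet> partial_v X u v"

definition g22 :: "patch \<Rightarrow> real \<Rightarrow> real \<Rightarrow> real" where
  "g22 X u v = partial_v X u v \<bullet> partial_v X u v"

definition W_squared :: "patch \<Rightarrow> real \<Rightarrow> real \<Rightarrow> real" where
  "W_squared X u v = g11 X u v * g22 X u v - (g12 X u v)\<^sup>2"

text \<open>
  Of the two unit normals we take the one oriented by \<open>X\<^sub>u \<times> X\<^sub>v\<close>. The Gaussian curvature,
  the mean curvature vector and its norm do not depend on this choice.
\<close>

definition unit_normal :: "patch \<Rightarrow> patch" where
  "unit_normal X u v = sgn (cross3 (partial_u X u v) (partial_v X u v))"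

definition L11 :: "patch \<Rightarrow> real \<Rightarrow> real \<Rightarrow> real" where
  "L11 X u v = partial_u (partial_u X) u v \<bullet> unit_normal X u v"

definition L12 :: "patch \<Rightarrow> real \<Rightarrow> real \<Rightarrow> real" where
  "L12 X u v = partial_v (partial_u X) u v \<bullet> unit_normal X u v"

definition L22 :: "patch \<Rightarrow> real \<Rightarrow> real \<Rightarrow> real" where
  "L22 X u v = partial_v (partial_v X) u v \<bullet> unit_normal X u v"

definition gaussian_curvature :: "patch \<Rightarrow> real \<Rightarrow> real \<Rightarrow> real" where
  "gaussian_curvature X u v =
     (L11 X u v * L22 X u v - (L12 X u v)\<^sup>2) / W_squared X u v"

definition mean_curvature_vector :: "patch \<Rightarrow> patch" where
  "mean_curvature_vector X u v =
     ((L11 X u v * g22 X u v + L22 X u v * g11 X u v - 2 * L12 X u v * g12 X u v)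
        / (2 * W_squared X u v)) *\<^sub>R unit_normal X u v"

definition mean_curvature :: "patch \<Rightarrow> real \<Rightarrow> real \<Rightarrow> real" where
  "mean_curvature X u v = norm (mean_curvature_vector X u v)"

definition spherical_patch :: "(real \<Rightarrow> real) \<Rightarrow> real \<Rightarrow> real \<Rightarrow> patch" where
  "spherical_patch \<phi> l c u v =
     vector [\<phi> u, l * cos (u / c) * cos v, l * cos (u / c) * sin v]"

end

theory Submission
  imports Defs
begin

text \<open>
  The patch is a surface of revolution whose profile curve \<open>(\<phi>, f)\<close>, \<open>f(u) = l cos(u/c)\<close>, is
  parametrised by arc length: the hypothesis on \<open>\<phi>'\<close> says exactly that \<open>\<phi>'\<^sup>2 + f'\<^sup>2 = 1\<close>.
  For such a surface both fundamental forms are diagonal, with principal curvatures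
  \<open>\<phi>'' f' - \<phi>' f''\<close> along the meridians and \<open>\<phi>' / f\<close> along the parallels. Differentiating
  the arc length condition gives \<open>\<phi>' \<phi>'' + f' f'' = 0\<close>, and this removes the second derivative
  of \<open>\<phi>\<close>: multiplied by \<open>\<phi>'\<close>, the meridian curvature becomes \<open>-f''\<close>. Hence \<open>K = -f'' / f\<close> and, where
  \<open>\<phi>' \<noteq> 0\<close>, \<open>H = \<bar>\<phi>'\<^sup>2 - f f''\<bar> / (2 f \<bar>\<phi>'\<bar>)\<close>. The profile \<open>l cos(u/c)\<close> satisfies
  \<open>f'' = -f/c\<^sup>2\<close>, so \<open>K\<close> is the constant \<open>1/c\<^sup>2\<close>. For the same reason the numerator of \<open>H\<close> is
  \<open>\<phi>'\<^sup>2 + f\<^sup>2/c\<^sup>2 > 0\<close>, so that its absolute value can be dropped, and the formula follows from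
  \<open>\<phi>'\<^sup>2 = 1 - (l\<^sup>2/c\<^sup>2) sin\<^sup>2(u/c)\<close>.
\<close>

definition revolution_patch :: "(real \<Rightarrow> real) \<Rightarrow> (real \<Rightarrow> real) \<Rightarrow> patch" where
  "revolution_patch \<phi> f u v = vector [\<phi> u, f u * cos v, f u * sin v]"

lemma has_vector_derivative_vector_3:
  fixes a b c :: "real \<Rightarrow> real"
  assumes "(a has_real_derivative a') (at x within S)" "(b has_real_derivative b') (at x within S)"
    and "(c has_real_derivative c') (at x within S)"
  shows "((\<lambda>s. vector [a s, b s, c s] :: real ^ 3) has_vector_derivative vector [a', b', c'])
    (at x within S)"
proof -
  have decompose: "(vector [x, y, z] :: real ^ 3) = x *\<^sub>R axis 1 1 + y *\<^sub>R axis 2 1 + z *\<^sub>R axis 3 1"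
    for x y z :: real
    by (simp add: vec_eq_iff forall_3 axis_def)
  show ?thesis
    unfolding decompose
    by (intro has_vector_derivative_add) (auto intro!: derivative_eq_intros assms
      has_vector_derivative_scaleR [THEN has_vector_derivative_eq_rhs])
qed

lemma vector_derivative_vector_3:
  fixes a b c :: "real \<Rightarrow> real"
  assumes "(a has_real_derivative a') (at x)" "(b has_real_derivative b') (at x)"
    and "(c has_real_derivative c') (at x)"
  shows "vector_derivative (\<lambda>s. vector [a s, b s, c s] :: real ^ 3) (at x) = vector [a', b', c']"
  by (intro vector_derivative_at has_vector_derivative_vector_3 assms)

lemma inner_vector_3:
  fixes a b c x y z :: real
  shows "(vector [a, b, c] :: real ^ 3) \<bullet> vector [x, y, z] = a * x + b * y + c * z"
  by (simp add: inner_vec_def sum_3)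

lemma derivative_of_unit_speed:
  fixes p q :: "real \<Rightarrow> real"
  assumes "open I" "u \<in> I" "\<And>s. s \<in> I \<Longrightarrow> (p s)\<^sup>2 + (q s)\<^sup>2 = 1"
    and p': "(p has_real_derivative p') (at u)" and q': "(q has_real_derivative q') (at u)"
  shows "p u * p' + q u * q' = 0"
proof -
  have "((\<lambda>s. (p s)\<^sup>2 + (q s)\<^sup>2) has_real_derivative 2 * (p u * p' + q u * q')) (at u)"
    by (auto intro!: derivative_eq_intros p' q' simp: algebra_simps)
  moreover have "((\<lambda>s. (p s)\<^sup>2 + (q s)\<^sup>2) has_real_derivative 0) (at u)"
    by (rule has_field_derivative_transform_within_open[where S = I and f = "\<lambda>_. 1"])
       (use assms in auto)
  ultimately have "2 * (p u * p' + q u * q') = 0"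
    by (rule DERIV_unique)
  then show ?thesis by simp
qed

text \<open>
  The derivatives of the profile are needed on the whole open set \<open>I\<close>: the second partial
  derivatives differentiate \<open>partial_u X\<close>, whose formula must hold near \<open>u\<close>. Unit speed of the
  profile turns the length of \<open>X\<^sub>u \<times> X\<^sub>v\<close> into the radius \<open>f u\<close>.
\<close>

lemma fundamental_forms_revolution_patch:
  fixes \<phi> f p q :: "real \<Rightarrow> real"
  assumes "open I" "u \<in> I"
    and \<phi>': "\<And>s. s \<in> I \<Longrightarrow> (\<phi> has_real_derivative p s) (at s)"
    and f': "\<And>s. s \<in> I \<Longrightarrow> (f has_real_derivative q s) (at s)"
    and p': "(p has_real_derivative p') (at u)" and q': "(q has_real_derivative q') (at u)"
    and unit: "(p u)\<^sup>2 + (q u)\<^sup>2 = 1" and pos: "f u > 0"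
  defines "X \<equiv> revolution_patch \<phi> f"
  shows "g11 X u v = 1" "g12 X u v = 0" "g22 X u v = (f u)\<^sup>2"
    and "L11 X u v = p' * q u - p u * q'" "L12 X u v = 0" "L22 X u v = p u * f u"
    and "norm (unit_normal X u v) = 1"
proof -
  have Xu: "partial_u X s t = vector [p s, q s * cos t, q s * sin t]" if "s \<in> I" for s t
    unfolding partial_u_def X_def revolution_patch_def
    by (rule vector_derivative_vector_3) (use that in \<open>auto intro!: derivative_eq_intros \<phi>' f'\<close>)
  have Xv: "partial_v X s t = vector [0, - (f s * sin t), f s * cos t]" for s t
    unfolding partial_v_def X_def revolution_patch_def
    by (rule vector_derivative_vector_3) (auto intro!: derivative_eq_intros)
  have Xuu: "partial_u (partial_u X) u v = vector [p', q' * cos v, q' * sin v]"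
    unfolding partial_u_def [of "partial_u X"]
  proof (rule vector_derivative_at)
    have "((\<lambda>s. vector [p s, q s * cos v, q s * sin v] :: real ^ 3)
            has_vector_derivative vector [p', q' * cos v, q' * sin v]) (at u)"
      by (rule has_vector_derivative_vector_3) (auto intro!: derivative_eq_intros p' q')
    then show "((\<lambda>s. partial_u X s v) has_vector_derivative
            vector [p', q' * cos v, q' * sin v]) (at u)"
      by (rule has_vector_derivative_transform_within_open) (use assms(1,2) Xu in auto)
  qed
  have Xuv: "partial_v (partial_u X) u v = vector [0, - (q u * sin v), q u * cos v]"
    unfolding partial_v_def [of "partial_u X"] Xu [OF \<open>u \<in> I\<close>]
    by (rule vector_derivative_vector_3) (auto intro!: derivative_eq_intros)
  have Xvv: "partial_v (partial_v X) u v = vector [0, - (f u * cos v), - (f u * sin v)]"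
    unfolding partial_v_def [of "partial_v X"] Xv
    by (rule vector_derivative_vector_3) (auto intro!: derivative_eq_intros)
  have trig: "(cos v)\<^sup>2 = 1 - (sin v)\<^sup>2"
    by (simp add: cos_squared_eq)
  have p_squared: "(p u)\<^sup>2 = 1 - (q u)\<^sup>2"
    using unit by simp
  define N :: "real ^ 3" where "N = vector [q u, - (p u * cos v), - (p u * sin v)]"
  have "N \<bullet> N = (q u)\<^sup>2 + (p u)\<^sup>2 * ((cos v)\<^sup>2 + (sin v)\<^sup>2)"
    unfolding N_def inner_vector_3 by algebra
  then have norm_N: "norm N = 1"
    using unit by (simp add: norm_eq_sqrt_inner)
  have "q u * cos v * (f u * cos v) + q u * sin v * (f u * sin v) = f u * q u"
    using trig by algebra
  then have "cross3 (partial_u X u v) (partial_v X u v) = f u *\<^sub>R N"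
    unfolding Xu [OF \<open>u \<in> I\<close>] Xv N_def by (simp add: cross3_def vec_eq_iff forall_3)
  then have normal: "unit_normal X u v = N"
    using pos norm_N by (simp add: unit_normal_def sgn_scaleR sgn_div_norm)
  show "norm (unit_normal X u v) = 1"
    by (simp add: normal norm_N)
  show "g11 X u v = 1"
    unfolding g11_def Xu [OF \<open>u \<in> I\<close>] inner_vector_3 using trig p_squared by algebra
  show "g12 X u v = 0"
    unfolding g12_def Xu [OF \<open>u \<in> I\<close>] Xv inner_vector_3 by simp
  show "g22 X u v = (f u)\<^sup>2"
    unfolding g22_def Xv inner_vector_3 using trig by algebra
  show "L11 X u v = p' * q u - p u * q'"
    unfolding L11_def normal N_def Xuu inner_vector_3 using trig by algebra
  show "L12 X u v = 0"
    unfolding L12_def normal N_def Xuv inner_vector_3 by simp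
  show "L22 X u v = p u * f u"
    unfolding L22_def normal N_def Xvv inner_vector_3 using trig by algebra
qed

text \<open>
  Both curvatures depend on the profile only through \<open>f\<close>, \<open>f''\<close> and \<open>\<phi>'\<close>. The reason is that
  \<open>\<phi>' L\<^sub>1\<^sub>1 = -f''\<close>, which combines the arc length condition with its derivative.
\<close>

lemma curvatures_unit_speed_revolution_patch:
  fixes \<phi> f p q :: "real \<Rightarrow> real"
  assumes "open I" "u \<in> I"
    and \<phi>': "\<And>s. s \<in> I \<Longrightarrow> (\<phi> has_real_derivative p s) (at s)"
    and f': "\<And>s. s \<in> I \<Longrightarrow> (f has_real_derivative q s) (at s)"
    and p': "(p has_real_derivative p') (at u)" and q': "(q has_real_derivative q') (at u)"
    and unit: "\<And>s. s \<in> I \<Longrightarrow> (p s)\<^sup>2 + (q s)\<^sup>2 = 1" and pos: "f u > 0"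
  shows gaussian_curvature_unit_speed_revolution_patch:
      "gaussian_curvature (revolution_patch \<phi> f) u v = - q' / f u"
    and mean_curvature_unit_speed_revolution_patch:
      "p u \<noteq> 0 \<Longrightarrow> mean_curvature (revolution_patch \<phi> f) u v
        = \<bar>(p u)\<^sup>2 - f u * q'\<bar> / (2 * f u * \<bar>p u\<bar>)"
proof -
  note forms = fundamental_forms_revolution_patch
    [OF assms(1,2) \<phi>' f' p' q' unit [OF \<open>u \<in> I\<close>] pos]
  define k where "k = p' * q u - p u * q'"
  have "p u * p' + q u * q' = 0"
    using derivative_of_unit_speed [OF assms(1,2) unit p' q'] .
  then have pk: "p u * k = - q'"
    using unit [OF \<open>u \<in> I\<close>] unfolding k_def by algebra
  have "gaussian_curvature (revolution_patch \<phi> f) u v = (p u * k) * f u / (f u)\<^sup>2"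
    by (simp add: gaussian_curvature_def W_squared_def forms k_def mult_ac)
  also have "\<dots> = - q' / f u"
    unfolding pk by (simp add: power2_eq_square)
  finally show "gaussian_curvature (revolution_patch \<phi> f) u v = - q' / f u" .
  show "mean_curvature (revolution_patch \<phi> f) u v
        = \<bar>(p u)\<^sup>2 - f u * q'\<bar> / (2 * f u * \<bar>p u\<bar>)" if "p u \<noteq> 0"
  proof -
    have "mean_curvature (revolution_patch \<phi> f) u v
        = \<bar>(k * (f u)\<^sup>2 + p u * f u) / (2 * (f u)\<^sup>2)\<bar>"
      by (simp add: mean_curvature_def mean_curvature_vector_def W_squared_def forms k_def)
    also have "(k * (f u)\<^sup>2 + p u * f u) / (2 * (f u)\<^sup>2)
        = ((p u)\<^sup>2 + f u * (p u * k)) / (2 * f u * p u)"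
      using pos that by (simp add: field_simps power2_eq_square)
    finally show ?thesis
      using pos by (simp add: pk abs_mult)
  qed
qed

theorem proposition4:
  fixes c l :: real and I :: "real set" and \<phi> :: "real \<Rightarrow> real"
  assumes "c \<noteq> 0" and "l > 0"
    and "open I" and "is_interval I"
    and "\<And>u. u \<in> I \<Longrightarrow> cos (u / c) > 0"
    and "\<And>u. u \<in> I \<Longrightarrow> 1 - l\<^sup>2 / c\<^sup>2 * (sin (u / c))\<^sup>2 > 0"
    and "smooth_real_on I \<phi>"
    and "\<And>u. u \<in> I \<Longrightarrow> \<bar>deriv \<phi> u\<bar> = sqrt (1 - l\<^sup>2 / c\<^sup>2 * (sin (u / c))\<^sup>2)"
  shows "\<forall>u\<in>I. \<forall>v.
      gaussian_curvature (spherical_patch \<phi> l c) u v = 1 / c\<^sup>2 \<and>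
      mean_curvature (spherical_patch \<phi> l c) u v =
        (2 * l\<^sup>2 / c\<^sup>2 * (cos (u / c))\<^sup>2 - l\<^sup>2 / c\<^sup>2 + 1) /
        (2 * l * cos (u / c) * sqrt (1 - l\<^sup>2 / c\<^sup>2 * (sin (u / c))\<^sup>2))"
proof (intro ballI allI)
  fix u v assume u: "u \<in> I"
  define f where "f = (\<lambda>s. l * cos (s / c))"
  define q where "q = (\<lambda>s. - (l / c * sin (s / c)))"
  define w where "w = 1 - l\<^sup>2 / c\<^sup>2 * (sin (u / c))\<^sup>2"
  have patch: "spherical_patch \<phi> l c = revolution_patch \<phi> f"
    by (simp add: fun_eq_iff spherical_patch_def revolution_patch_def f_def)
  have \<phi>': "(\<phi> has_real_derivative deriv \<phi> s) (at s)" if "s \<in> I" for s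
    using assms(7) that unfolding smooth_real_on_def
    by (auto dest!: spec [of _ 0] bspec intro: field_differentiable_derivI)
  have \<phi>'': "(deriv \<phi> has_real_derivative deriv (deriv \<phi>) u) (at u)"
    using assms(7) u unfolding smooth_real_on_def
    by (auto dest!: spec [of _ 1] bspec intro: field_differentiable_derivI)
  have f': "(f has_real_derivative q s) (at s)" for s
    unfolding f_def q_def using \<open>c \<noteq> 0\<close> by (auto intro!: derivative_eq_intros)
  have q': "(q has_real_derivative - (f u / c\<^sup>2)) (at u)"
    unfolding f_def q_def using \<open>c \<noteq> 0\<close>
    by (auto intro!: derivative_eq_intros simp: power2_eq_square)
  have \<phi>'_squared: "(deriv \<phi> s)\<^sup>2 = 1 - l\<^sup>2 / c\<^sup>2 * (sin (s / c))\<^sup>2" if "s \<in> I" for s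
    using assms(6,8) [OF that] by (metis less_imp_le power2_abs real_sqrt_pow2)
  have unit: "(deriv \<phi> s)\<^sup>2 + (q s)\<^sup>2 = 1" if "s \<in> I" for s
    using \<phi>'_squared [OF that] by (simp add: q_def power_mult_distrib power_divide)
  have pos: "f u > 0"
    using assms(2,5) u by (simp add: f_def)
  have w: "w > 0" "\<bar>deriv \<phi> u\<bar> = sqrt w" "(deriv \<phi> u)\<^sup>2 = w"
    using assms(6,8) u \<phi>'_squared by (simp_all add: w_def)
  note curvatures = curvatures_unit_speed_revolution_patch
    [OF \<open>open I\<close> u \<phi>' f' \<phi>'' q' unit pos]
  have K: "gaussian_curvature (revolution_patch \<phi> f) u v = 1 / c\<^sup>2"
    using pos by (simp add: curvatures(1))
  have numerator: "w + (f u)\<^sup>2 / c\<^sup>2 = 2 * l\<^sup>2 / c\<^sup>2 * (cos (u / c))\<^sup>2 - l\<^sup>2 / c\<^sup>2 + 1"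
    by (simp add: w_def f_def power_mult_distrib sin_squared_eq diff_divide_distrib algebra_simps)
  have "deriv \<phi> u \<noteq> 0"
    using w by auto
  then have "mean_curvature (revolution_patch \<phi> f) u v
      = \<bar>w + (f u)\<^sup>2 / c\<^sup>2\<bar> / (2 * f u * sqrt w)"
    by (simp add: curvatures(2) w power2_eq_square [of "f u"])
  also have "\<bar>w + (f u)\<^sup>2 / c\<^sup>2\<bar> = w + (f u)\<^sup>2 / c\<^sup>2"
    using w(1) by (simp add: add_nonneg_nonneg)
  finally have H: "mean_curvature (revolution_patch \<phi> f) u v
      = (2 * l\<^sup>2 / c\<^sup>2 * (cos (u / c))\<^sup>2 - l\<^sup>2 / c\<^sup>2 + 1) / (2 * l * cos (u / c) * sqrt w)"
    unfolding numerator by (simp add: f_def mult_ac)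
  show "gaussian_curvature (spherical_patch \<phi> l c) u v = 1 / c\<^sup>2 \<and>
      mean_curvature (spherical_patch \<phi> l c) u v =
        (2 * l\<^sup>2 / c\<^sup>2 * (cos (u / c))\<^sup>2 - l\<^sup>2 / c\<^sup>2 + 1) /
        (2 * l * cos (u / c) * sqrt (1 - l\<^sup>2 / c\<^sup>2 * (sin (u / c))\<^sup>2))"
    using K H by (simp only: patch w_def)
qed

end
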